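(* Let $X$ be a Fréchet sequence space over $\mathbb{Z}$, with seminorms $(\|\cdot\|_n)_{n\in\mathbb{N}}$, endowed with the compatible metric $d$. Suppose that the sequence $(e_n)_{n\in\mathbb{Z}}$ of canonical vectors is a basis and that for each $n\in\mathbb{N}$, $m\in\mathbb{Z}$ and $x=(x_j)_{j\in\mathbb{Z}}\in X$ we have $|x_m|\,\|e_m\|_n\le\|x\|_n$. Suppose that the bilateral weighted backward shift $B_w$, with nonzero weights $w:=(w_n)_{n\in\mathbb{Z}}$, is well-defined and continuous on $X$. Then $B_w$ is mean Li--Yorke chaotic if and only if the following conditions hold: (A) $\liminf_{n\to\infty}\frac{1}{n}\sum_{k=1}^{n}d(w_{-k}\cdots w_{-1}e_{-k},0)=0$; (B) there exist $\varepsilon>0$ and an increasing sequence $(N_k)_{k\in\mathbb{N}}$ of positive integers such that for each $k\in\mathbb{N}$ there are $r:=r(k)\in\mathbb{N}$ and scalars $b_{-r,k},\dots,b_{r,k}\in\mathbb{K}$ with $d\left(\sum_{j=-r}^{r}b_{j,k}e_j,0\right)<\frac{1}{k}$ and $$\frac{1}{N_k}\sum_{i=1}^{N_k}d\left(\sum_{j=-r}^{r}b_{j,k}w_{j-i}\cdots w_{j-1}e_{j-i},0\right)\ge\varepsilon.$$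
   Context: $\mathbb{K}$ is $\mathbb{R}$ or $\mathbb{C}$; $\mathbb{N}=\{1,2,3,\dots\}$. A Fréchet space is a vector space $X$ over $\mathbb{K}$ endowed with an increasing sequence $(\|\cdot\|_k)_{k\in\mathbb{N}}$ of seminorms such that $d(x,y):=\sum_{k=1}^{\infty}2^{-k}\min\{1,\|x-y\|_k\}$ is a metric under which $X$ is complete; this $d$ is called the compatible metric. A Fréchet sequence space over $\mathbb{Z}$ is a Fréchet space $X$ that is a vector subspace of $\mathbb{K}^{\mathbb{Z}}$ such that the inclusion $X\to\mathbb{K}^{\mathbb{Z}}$ is continuous (convergence in $X$ implies coordinatewise convergence). The canonical vectors $e_n:=(\delta_{n,j})_{j\in\mathbb{Z}}$, $n\in\mathbb{Z}$, form a basis of $X$ if they belong to $X$ and $x=\sum_{n=-\infty}^{\infty}x_ne_n$ in $X$ for every $x=(x_n)_{n\in\mathbb{Z}}\in X$ (as usual, a two-sided series converges when both $\sum_{n\ge 0}$ and $\sum_{n<0}$ converge in $X$). For a sequence $w=(w_n)_{n\in\mathbb{Z}}$ of nonzero scalars, the bilateral weighted backward shift is $B_w((x_n)_{n\in\mathbb{Z}}):=(w_nx_{n+1})_{n\in\mathbb{Z}}$; it is well-defined on $X$ if it maps $X$ into itself. A continuous map $f:M\to M$ on a metric space $(M,d)$ is mean Li--Yorke chaotic if there exists an uncountable set $S\subset M$ such that every pair $(x,y)\in S\times S$ of distinct points satisfies $$\liminf_{n\to\infty}\frac1n\sum_{k=1}^{n}d(f^k(x),f^k(y))=0\quad\text{and}\quad\limsup_{n\to\infty}\frac1n\sum_{k=1}^{n}d(f^k(x),f^k(y))>0.$$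 *)

theory Defs
  imports "HOL-Analysis.Analysis" "HOL-Library.Function_Algebras"
begin

text \<open>
  The scalar field is either the reals or the complex numbers, with the usual absolute value as
  norm. The class pins this down up to isometric isomorphism over the reals.
\<close>

class real_or_complex = real_normed_field +
  assumes real_or_complex:
    "(\<forall>z. \<exists>a. z = a *\<^sub>R 1) \<or>
     (\<exists>i. i * i = - 1 \<and> (\<forall>z. \<exists>a b. z = a *\<^sub>R 1 + b *\<^sub>R i) \<and>
          (\<forall>a b. norm (a *\<^sub>R 1 + b *\<^sub>R i) = sqrt (a\<^sup>2 + b\<^sup>2)))"

instance real :: real_or_complex
  by standard simp

instance complex :: real_or_complex
proof
  have "\<forall>z. \<exists>a b. z = a *\<^sub>R 1 + b *\<^sub>R \<i>"
    by (metis complex_eq mult.commute of_real_def scaleR_conv_of_real)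
  moreover have "\<forall>a b. norm (a *\<^sub>R 1 + b *\<^sub>R \<i>) = sqrt (a\<^sup>2 + b\<^sup>2)"
    by (simp add: cmod_def)
  ultimately show "(\<forall>z::complex. \<exists>a. z = a *\<^sub>R 1) \<or>
     (\<exists>i::complex. i * i = - 1 \<and> (\<forall>z. \<exists>a b. z = a *\<^sub>R 1 + b *\<^sub>R i) \<and>
          (\<forall>a b. norm (a *\<^sub>R 1 + b *\<^sub>R i) = sqrt (a\<^sup>2 + b\<^sup>2)))"
    using i_squared by blast
qed

text \<open>
  The seminorms are \<open>p 1, p 2, ...\<close>; the value \<open>p 0\<close> is never used, and neither are values outside
  the carrier \<open>X\<close>. The compatible metric is set to 0 off \<open>X\<close> only because
  \<^locale>\<open>Metric_space\<close> asks for nonnegativity and symmetry on the whole type.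
\<close>

definition frechet_dist :: "'b::ab_group_add set \<Rightarrow> (nat \<Rightarrow> 'b \<Rightarrow> real) \<Rightarrow> 'b \<Rightarrow> 'b \<Rightarrow> real" where
  "frechet_dist X p x y =
     (if x \<in> X \<and> y \<in> X then (\<Sum>k. (1/2) ^ Suc k * min 1 (p (Suc k) (x - y))) else 0)"

locale frechet_space = vector_space scale
  for scale :: "'k::real_or_complex \<Rightarrow> 'b::ab_group_add \<Rightarrow> 'b" +
  fixes X :: "'b set" and p :: "nat \<Rightarrow> 'b \<Rightarrow> real"
  assumes subspace: "subspace X"
    and seminorm_nonneg: "\<And>k x. k \<ge> 1 \<Longrightarrow> x \<in> X \<Longrightarrow> 0 \<le> p k x"
    and seminorm_scale: "\<And>k c x. k \<ge> 1 \<Longrightarrow> x \<in> X \<Longrightarrow> p k (scale c x) = norm c * p k x"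
    and seminorm_triangle:
      "\<And>k x y. k \<ge> 1 \<Longrightarrow> x \<in> X \<Longrightarrow> y \<in> X \<Longrightarrow> p k (x + y) \<le> p k x + p k y"
    and seminorm_increasing: "\<And>k x. k \<ge> 1 \<Longrightarrow> x \<in> X \<Longrightarrow> p k x \<le> p (Suc k) x"
    and metric: "Metric_space X (frechet_dist X p)"
    and complete: "Metric_space.mcomplete X (frechet_dist X p)"

definition seq_scale :: "'k::field \<Rightarrow> (int \<Rightarrow> 'k) \<Rightarrow> int \<Rightarrow> 'k" where
  "seq_scale c x = (\<lambda>n. c * x n)"

lemma vector_space_seq_scale: "vector_space (seq_scale :: 'k::field \<Rightarrow> _)"
  by unfold_locales (auto simp: seq_scale_def fun_eq_iff algebra_simps)

abbreviation frechet_topology :: "'b::ab_group_add set \<Rightarrow> (nat \<Rightarrow> 'b \<Rightarrow> real) \<Rightarrow> 'b topology" where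
  "frechet_topology X p \<equiv> Metric_space.mtopology X (frechet_dist X p)"

locale frechet_sequence_space = frechet_space seq_scale X p
  for X :: "(int \<Rightarrow> 'k::real_or_complex) set" and p +
  assumes continuous_inclusion:
    "continuous_map (frechet_topology X p) (product_topology (\<lambda>_. euclidean) UNIV) (\<lambda>x. x)"

definition canonical_vector :: "int \<Rightarrow> int \<Rightarrow> 'k::field" where
  "canonical_vector n = (\<lambda>j. if j = n then 1 else 0)"

definition canonical_basis ::
    "(int \<Rightarrow> 'k::real_or_complex) set \<Rightarrow> (nat \<Rightarrow> (int \<Rightarrow> 'k) \<Rightarrow> real) \<Rightarrow> bool" where
  "canonical_basis X p \<longleftrightarrow>
     range canonical_vector \<subseteq> X \<and>
     (\<forall>x\<in>X. \<exists>y z. x = y + z \<and>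
        limitin (frechet_topology X p)
          (\<lambda>N. \<Sum>n<N. seq_scale (x (int n)) (canonical_vector (int n))) y sequentially \<and>
        limitin (frechet_topology X p)
          (\<lambda>N. \<Sum>n=1..N. seq_scale (x (- int n)) (canonical_vector (- int n))) z sequentially)"

definition weighted_shift :: "(int \<Rightarrow> 'k::field) \<Rightarrow> (int \<Rightarrow> 'k) \<Rightarrow> int \<Rightarrow> 'k" where
  "weighted_shift w x = (\<lambda>n. w n * x (n + 1))"

definition (in Metric_space) mean_Li_Yorke_chaotic :: "('a \<Rightarrow> 'a) \<Rightarrow> bool" where
  "mean_Li_Yorke_chaotic f \<longleftrightarrow>
     continuous_map mtopology mtopology f \<and>
     (\<exists>S\<subseteq>M. uncountable S \<and>
       (\<forall>x\<in>S. \<forall>y\<in>S. x \<noteq> y \<longrightarrow>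
          liminf (\<lambda>n. ereal (1 / real n * (\<Sum>k=1..n. d ((f ^^ k) x) ((f ^^ k) y)))) = 0 \<and>
          limsup (\<lambda>n. ereal (1 / real n * (\<Sum>k=1..n. d ((f ^^ k) x) ((f ^^ k) y)))) > 0))"

end

theory Submission
  imports Defs
begin

text \<open>
  Let \<open>A n x\<close> be the mean of \<open>d (T^k x, 0)\<close> over \<open>1 \<le> k \<le> n\<close>. For linear \<open>T\<close>, mean Li-Yorke chaos
  is equivalent to a single vector \<open>x\<close> with \<open>liminf A n x = 0 < limsup A n x\<close>: a difference of two
  scrambled points is such a vector, and conversely its real multiples form a scrambled set.

  If such an \<open>x\<close> exists, some coordinate \<open>x m\<close> is nonzero, and the coordinate inequality bounds
  \<open>A n (x m e_m)\<close> by \<open>A n x\<close>; since the weights do not vanish, all canonical vectors lie, up to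
  scalars, on common orbits, which gives (A). For (B), the orbit of \<open>x\<close> comes arbitrarily close
  to 0 while its means stay large infinitely often; truncate such an orbit point.

  Conversely, (A) makes all finitely supported vectors proximal to 0, so that vectors with
  \<open>liminf A n x = 0\<close> form a residual set. By (B), adding a small vector to any point makes some
  late orbit mean large, so that vectors with \<open>limsup A n x > 0\<close> contain a residual set too, and
  Baire's theorem provides a common element.
\<close>

subsection \<open>Lower and upper limits of real sequences\<close>

text \<open>Restating limits as inequalities at frequently many indices lets later arguments
  intersect them with eventual conditions. Nonnegativity supplies the bound from below.\<close>

lemma liminf_ereal_eq_0_iff:
  fixes f :: "nat \<Rightarrow> real"
  assumes "\<And>n. 0 \<le> f n"
  shows "liminf (\<lambda>n. ereal (f n)) = 0 \<longleftrightarrow> (\<forall>e>0. \<exists>\<^sub>F n in sequentially. f n < e)"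
proof
  assume L: "liminf (\<lambda>n. ereal (f n)) = 0"
  show "\<forall>e>0. \<exists>\<^sub>F n in sequentially. f n < e"
  proof (intro allI impI, rule ccontr)
    fix e :: real
    assume "0 < e" and "\<not> (\<exists>\<^sub>F n in sequentially. f n < e)"
    then have "\<forall>\<^sub>F n in sequentially. ereal e \<le> ereal (f n)"
      by (simp add: not_frequently not_less)
    then have "ereal e \<le> liminf (\<lambda>n. ereal (f n))"
      by (rule Liminf_bounded)
    with L \<open>0 < e\<close> show False by simp
  qed
next
  assume R: "\<forall>e>0. \<exists>\<^sub>F n in sequentially. f n < e"
  have "0 \<le> liminf (\<lambda>n. ereal (f n))"
    by (rule Liminf_bounded) (simp add: assms)
  moreover have "\<not> 0 < liminf (\<lambda>n. ereal (f n))"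
  proof
    assume "0 < liminf (\<lambda>n. ereal (f n))"
    then obtain e where e: "0 < ereal e" "ereal e < liminf (\<lambda>n. ereal (f n))"
      using ereal_dense2 by blast
    then have "\<forall>\<^sub>F n in sequentially. ereal e < ereal (f n)"
      by (intro less_LiminfD)
    then have "\<forall>\<^sub>F n in sequentially. \<not> f n < e"
      by eventually_elim simp
    with R e show False by (simp add: frequently_def)
  qed
  ultimately show "liminf (\<lambda>n. ereal (f n)) = 0" by simp
qed

lemma limsup_ereal_pos_iff:
  fixes f :: "nat \<Rightarrow> real"
  shows "0 < limsup (\<lambda>n. ereal (f n)) \<longleftrightarrow> (\<exists>e>0. \<exists>\<^sub>F n in sequentially. e < f n)"
proof
  assume "0 < limsup (\<lambda>n. ereal (f n))"
  then obtain e where e: "0 < ereal e" "ereal e < limsup (\<lambda>n. ereal (f n))"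
    using ereal_dense2 by blast
  have "\<exists>\<^sub>F n in sequentially. e < f n"
  proof (rule ccontr)
    assume "\<not> ?thesis"
    then have "\<forall>\<^sub>F n in sequentially. ereal (f n) \<le> ereal e"
      by (simp add: not_frequently not_less)
    then have "limsup (\<lambda>n. ereal (f n)) \<le> ereal e"
      by (rule Limsup_bounded)
    with e show False by simp
  qed
  with e show "\<exists>e>0. \<exists>\<^sub>F n in sequentially. e < f n" by auto
next
  assume "\<exists>e>0. \<exists>\<^sub>F n in sequentially. e < f n"
  then obtain e where e: "0 < e" "\<exists>\<^sub>F n in sequentially. e < f n" by blast
  show "0 < limsup (\<lambda>n. ereal (f n))"
  proof (rule ccontr)
    assume "\<not> ?thesis"
    then have "limsup (\<lambda>n. ereal (f n)) < ereal e"
      using e by (metis ereal_less(2) leI order_le_less_trans)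
    then have "\<forall>\<^sub>F n in sequentially. ereal (f n) < ereal e"
      by (rule Limsup_lessD)
    then have "\<forall>\<^sub>F n in sequentially. \<not> e < f n"
      by eventually_elim simp
    with e show False by (simp add: frequently_def)
  qed
qed

subsection \<open>The compatible metric as an F-norm\<close>

context frechet_space
begin

sublocale M: Metric_space X "frechet_dist X p"
  by (rule metric)

abbreviation fnorm :: "'b \<Rightarrow> real"
  where "fnorm x \<equiv> frechet_dist X p x 0"

lemma zero_in: "0 \<in> X" and add_in: "x \<in> X \<Longrightarrow> y \<in> X \<Longrightarrow> x + y \<in> X"
  and diff_in: "x \<in> X \<Longrightarrow> y \<in> X \<Longrightarrow> x - y \<in> X"
  and scale_in: "x \<in> X \<Longrightarrow> scale c x \<in> X"
  and sum_in: "(\<And>i. i \<in> I \<Longrightarrow> f i \<in> X) \<Longrightarrow> sum f I \<in> X"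
  by (auto intro: subspace_0 subspace_add subspace_diff subspace_scale subspace_sum subspace)

lemma fnorm_eq: "x \<in> X \<Longrightarrow> fnorm x = (\<Sum>k. (1/2) ^ Suc k * min 1 (p (Suc k) x))"
  by (simp add: frechet_dist_def zero_in)

lemma frechet_dist_eq_fnorm: "x \<in> X \<Longrightarrow> y \<in> X \<Longrightarrow> frechet_dist X p x y = fnorm (x - y)"
  by (simp add: frechet_dist_def zero_in diff_in)

lemma sums_half_powers: "(\<lambda>k. (1/2::real) ^ Suc k) sums 1"
  using power_half_series by simp

lemma summable_fnorm:
  assumes "x \<in> X"
  shows "summable (\<lambda>k. (1/2) ^ Suc k * min 1 (p (Suc k) x))"
proof (rule summable_comparison_test')
  show "summable (\<lambda>k. (1/2::real) ^ Suc k)"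
    using sums_half_powers by (rule sums_summable)
  show "norm ((1/2) ^ Suc k * min 1 (p (Suc k) x)) \<le> (1/2) ^ Suc k" if "k \<ge> 0" for k
    using seminorm_nonneg[of "Suc k" x] assms by (simp add: abs_mult)
qed

text \<open>The weights sum to 1. This uniform bound is what makes a shift in time cost only 1/n in
  the orbit means.\<close>

lemma fnorm_le_1: "x \<in> X \<Longrightarrow> fnorm x \<le> 1"
  unfolding fnorm_eq
  by (rule order_trans[OF suminf_le[of _ "\<lambda>k. (1/2) ^ Suc k"]])
     (use summable_fnorm sums_half_powers[THEN sums_unique] sums_half_powers[THEN sums_summable]
       in \<open>auto simp: min_def\<close>)

lemma fnorm_mono:
  assumes "x \<in> X" "y \<in> X" "\<And>k. k \<ge> 1 \<Longrightarrow> p k x \<le> p k y"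
  shows "fnorm x \<le> fnorm y"
  unfolding fnorm_eq[OF assms(1)] fnorm_eq[OF assms(2)]
  by (intro suminf_le summable_fnorm assms mult_left_mono min.mono) auto

text \<open>Translation invariance: in the metric triangle inequality through the point
  \<open>y\<close>, the distance from \<open>x + y\<close> to \<open>y\<close> is the F-norm of
  \<open>x\<close>.\<close>

lemma fnorm_triangle:
  assumes "x \<in> X" "y \<in> X"
  shows "fnorm (x + y) \<le> fnorm x + fnorm y"
  using M.triangle[of "x + y" y 0] frechet_dist_eq_fnorm[of "x + y" y] assms
  by (simp add: add_in zero_in)

text \<open>The F-norm is not homogeneous. Termwise, the summand 1 of the factor covers seminorm
  values of at least 1, where truncation occurs, and \<open>norm c\<close> covers the smaller
  ones.\<close>

lemma fnorm_scale_le: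
  assumes "x \<in> X"
  shows "fnorm (scale c x) \<le> (1 + norm c) * fnorm x"
proof -
  have "fnorm (scale c x) \<le> (\<Sum>k. (1 + norm c) * ((1/2) ^ Suc k * min 1 (p (Suc k) x)))"
    unfolding fnorm_eq[OF scale_in[OF assms]]
  proof (intro suminf_le summable_fnorm summable_mult scale_in assms)
    fix k
    have "min 1 (norm c * p (Suc k) x) \<le> (1 + norm c) * min 1 (p (Suc k) x)"
      using seminorm_nonneg[of "Suc k" x] assms
      by (auto simp: min_def algebra_simps intro: add_increasing2)
    then show "(1/2) ^ Suc k * min 1 (p (Suc k) (scale c x))
        \<le> (1 + norm c) * ((1/2) ^ Suc k * min 1 (p (Suc k) x))"
      using mult_left_mono[of _ _ "(1/2::real) ^ Suc k"]
      by (simp add: seminorm_scale assms mult.left_commute)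
  qed
  also have "\<dots> = (1 + norm c) * fnorm x"
    unfolding fnorm_eq[OF assms] by (intro suminf_mult summable_fnorm assms)
  finally show ?thesis .
qed

end

subsection \<open>Orbit means of continuous linear operators\<close>

locale frechet_operator = frechet_space scale X p
  for scale :: "'k::real_or_complex \<Rightarrow> 'b::ab_group_add \<Rightarrow> 'b" and X p +
  fixes T :: "'b \<Rightarrow> 'b"
  assumes T_in: "x \<in> X \<Longrightarrow> T x \<in> X"
    and T_add: "x \<in> X \<Longrightarrow> y \<in> X \<Longrightarrow> T (x + y) = T x + T y"
    and T_scale: "x \<in> X \<Longrightarrow> T (scale c x) = scale c (T x)"
    and T_cont: "continuous_map (frechet_topology X p) (frechet_topology X p) T"
begin

lemma power_in: "x \<in> X \<Longrightarrow> (T ^^ n) x \<in> X"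
  by (induction n) (auto intro: T_in)

lemma power_add: "x \<in> X \<Longrightarrow> y \<in> X \<Longrightarrow> (T ^^ n) (x + y) = (T ^^ n) x + (T ^^ n) y"
  by (induction n) (auto simp: T_add power_in)

lemma power_scale: "x \<in> X \<Longrightarrow> (T ^^ n) (scale c x) = scale c ((T ^^ n) x)"
  by (induction n) (auto simp: T_scale power_in)

lemma power_diff: "x \<in> X \<Longrightarrow> y \<in> X \<Longrightarrow> (T ^^ n) (x - y) = (T ^^ n) x - (T ^^ n) y"
  using power_add[of "x - y" y n] by (simp add: diff_in)

lemma power_sum:
  assumes "finite I" "\<And>i. i \<in> I \<Longrightarrow> f i \<in> X"
  shows "(T ^^ n) (sum f I) = (\<Sum>i\<in>I. (T ^^ n) (f i))"
  using assms
proof (induction rule: finite_induct)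
  case empty
  \<comment> \<open>Powers of \<open>T\<close> fix 0 because 0 = 0 - 0.\<close>
  show ?case using power_diff[OF zero_in zero_in, of n] by simp
qed (simp add: power_add sum_in)

lemma power_cont: "continuous_map (frechet_topology X p) (frechet_topology X p) (T ^^ n)"
proof (induction n)
  case 0
  show ?case by (simp add: id_def[symmetric])
next
  case (Suc n)
  then show ?case
    using continuous_map_compose[OF Suc T_cont] by (simp add: comp_def)
qed

definition orbit_mean :: "nat \<Rightarrow> 'b \<Rightarrow> real"
  where "orbit_mean n x = 1 / real n * (\<Sum>k=1..n. fnorm ((T ^^ k) x))"

lemma orbit_mean_nonneg: "0 \<le> orbit_mean n x"
  by (auto simp: orbit_mean_def intro!: divide_nonneg_nonneg sum_nonneg)

lemma orbit_mean_zero: "orbit_mean n 0 = 0"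
  using power_sum[of "{}"] by (simp add: orbit_mean_def zero_in)

lemma mean_dist_eq_orbit_mean:
  assumes "x \<in> X" "y \<in> X"
  shows "1 / real n * (\<Sum>k=1..n. frechet_dist X p ((T ^^ k) x) ((T ^^ k) y))
    = orbit_mean n (x - y)"
  by (simp add: orbit_mean_def frechet_dist_eq_fnorm power_in power_diff assms)

lemma orbit_mean_add_le:
  assumes "x \<in> X" "y \<in> X"
  shows "orbit_mean n (x + y) \<le> orbit_mean n x + orbit_mean n y"
proof -
  have "(\<Sum>k=1..n. fnorm ((T ^^ k) (x + y)))
      \<le> (\<Sum>k=1..n. fnorm ((T ^^ k) x) + fnorm ((T ^^ k) y))"
    by (intro sum_mono) (simp add: power_add fnorm_triangle power_in assms)
  then show ?thesis
    unfolding orbit_mean_def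
    by (simp add: sum.distrib divide_right_mono flip: add_divide_distrib)
qed

lemma orbit_mean_scale_le:
  assumes "x \<in> X"
  shows "orbit_mean n (scale c x) \<le> (1 + norm c) * orbit_mean n x"
proof -
  have "(\<Sum>k=1..n. fnorm ((T ^^ k) (scale c x)))
      \<le> (1 + norm c) * (\<Sum>k=1..n. fnorm ((T ^^ k) x))"
    unfolding sum_distrib_left
    by (intro sum_mono) (simp add: power_scale fnorm_scale_le power_in assms)
  from divide_right_mono[OF this, of "real n"] show ?thesis
    by (simp add: orbit_mean_def)
qed

text \<open>Replacing \<open>x\<close> by \<open>T x\<close> moves the window of summation by one,
  so only the end terms change.\<close>

lemma sum_orbit_shift:
  "(\<Sum>k=1..n. fnorm ((T ^^ k) (T x))) = (\<Sum>k=1..n. fnorm ((T ^^ k) x))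
     + fnorm ((T ^^ Suc n) x) - fnorm (T x)"
  by (induction n) (simp_all add: funpow_swap1)

text \<open>The two end terms of the moved window lie in [0, 1], hence the sums differ by at most
  1.\<close>

lemma orbit_mean_image_le:
  assumes "x \<in> X"
  shows "orbit_mean n (T x) \<le> orbit_mean n x + 1 / real n"
    and "orbit_mean n x \<le> orbit_mean n (T x) + 1 / real n"
proof -
  let ?S = "\<lambda>x. \<Sum>k=1..n. fnorm ((T ^^ k) x)"
  have "fnorm ((T ^^ Suc n) x) \<le> 1" "fnorm (T x) \<le> 1"
    using power_in[OF assms, of "Suc n"] T_in[OF assms] by (auto simp: fnorm_le_1)
  then have "?S (T x) \<le> ?S x + 1" "?S x \<le> ?S (T x) + 1"
    using M.nonneg[of "(T ^^ Suc n) x" 0] M.nonneg[of "T x" 0] sum_orbit_shift[of x n]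
    by linarith+
  from this[THEN divide_right_mono, of "real n"]
  show "orbit_mean n (T x) \<le> orbit_mean n x + 1 / real n"
    and "orbit_mean n x \<le> orbit_mean n (T x) + 1 / real n"
    by (simp_all add: orbit_mean_def add_divide_distrib)
qed

lemma orbit_mean_power_le:
  assumes "x \<in> X"
  shows "orbit_mean n ((T ^^ m) x) \<le> orbit_mean n x + real m / real n"
    and "orbit_mean n x \<le> orbit_mean n ((T ^^ m) x) + real m / real n"
proof (induction m)
  case (Suc m)
  {
    case 1
    show ?case using Suc orbit_mean_image_le[OF power_in[OF assms, of m], of n]
      by (simp add: add_divide_distrib)
  next
    case 2
    show ?case using Suc orbit_mean_image_le[OF power_in[OF assms, of m], of n]
      by (simp add: add_divide_distrib)
  }
qed simp_all

lemma continuous_fnorm_power: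
  "continuous_map (frechet_topology X p) euclideanreal (\<lambda>x. fnorm ((T ^^ k) x))"
  using continuous_map_mdist[of "frechet_topology X p" "metric (X, frechet_dist X p)" "T ^^ k" "\<lambda>_. 0"]
  by (simp add: power_cont zero_in)

text \<open>Used twice: it makes the level sets in the Baire argument open, and it lets truncations
  of a vector inherit a large mean at a fixed time.\<close>

lemma continuous_orbit_mean:
  "continuous_map (frechet_topology X p) euclideanreal (orbit_mean n)"
  unfolding orbit_mean_def
  by (intro continuous_map_real_mult_left continuous_map_sum continuous_fnorm_power) auto

text \<open>By \<open>liminf_ereal_eq_0_iff\<close>, this says that the orbit means of
  \<open>x\<close> have lower limit 0.\<close>

definition mean_proximal_to_0 :: "'b \<Rightarrow> bool"
  where "mean_proximal_to_0 x \<longleftrightarrow> (\<forall>e>0. \<exists>\<^sub>F n in sequentially. orbit_mean n x < e)"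

definition mean_semi_irregular :: "'b \<Rightarrow> bool"
  where "mean_semi_irregular x \<longleftrightarrow>
    mean_proximal_to_0 x \<and> (\<exists>e>0. \<exists>\<^sub>F n in sequentially. e < orbit_mean n x)"

lemma orbit_comes_near_0:
  assumes "mean_proximal_to_0 x" "d > 0"
  obtains j where "fnorm ((T ^^ j) x) < d"
proof (rule ccontr)
  assume "\<not> thesis"
  then have *: "d \<le> fnorm ((T ^^ j) x)" for j
    using \<open>\<not> thesis\<close> that[of j] by linarith
  \<comment> \<open>Index 0 must be avoided: division by zero makes the mean there 0. At a positive
    index, a bound \<open>d\<close> below the whole orbit would bound the mean from below.\<close>
  obtain n where n: "n \<ge> 1" "orbit_mean n x < d"
    using assms unfolding mean_proximal_to_0_def frequently_sequentially by blast
  have "real n * d \<le> (\<Sum>k=1..n. fnorm ((T ^^ k) x))"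
    using sum_bounded_below[of "{1..n}" d "\<lambda>k. fnorm ((T ^^ k) x)"] * by simp
  with n show False
    by (simp add: orbit_mean_def field_simps)
qed

lemma mean_semi_irregular_nonzero: "mean_semi_irregular x \<Longrightarrow> x \<noteq> 0"
  by (auto simp: mean_semi_irregular_def orbit_mean_zero)

text \<open>
  The lower limit of the orbit means is not subadditive, whereas the vectors dominated by a fixed
  \<open>u\<close> form a subspace that contains every \<open>y\<close> having \<open>u\<close> in its orbit.
\<close>

definition orbit_dominated :: "'b \<Rightarrow> 'b \<Rightarrow> bool"
  where "orbit_dominated u x \<longleftrightarrow>
    (\<exists>C\<ge>0. \<forall>n. orbit_mean n x \<le> C * (orbit_mean n u + 1 / real n))"

text \<open>The times at which the mean of \<open>u\<close> is small can be taken late, so that 1/n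
  is small as well; the same times then serve for \<open>x\<close>.\<close>

lemma mean_proximal_dominated:
  assumes "mean_proximal_to_0 u" "orbit_dominated u x"
  shows "mean_proximal_to_0 x"
  unfolding mean_proximal_to_0_def
proof (intro allI impI)
  fix e :: real assume "e > 0"
  obtain C where C: "C \<ge> 0" "\<And>n. orbit_mean n x \<le> C * (orbit_mean n u + 1 / real n)"
    using assms(2) unfolding orbit_dominated_def by blast
  \<comment> \<open>Each of the two summands in the bound will be below \<open>d\<close>; the
    denominator uses \<open>C + 1\<close> because \<open>C\<close> may be 0.\<close>
  define d where "d = e / (2 * (C + 1))"
  have d: "d > 0" "C * (2 * d) < e"
    using C \<open>e > 0\<close> by (auto simp: d_def field_simps)
  have "\<exists>\<^sub>F n in sequentially. orbit_mean n u < d"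
    using assms(1) d unfolding mean_proximal_to_0_def by blast
  moreover have "\<forall>\<^sub>F n in sequentially. 1 / real n < d"
    using order_tendstoD(2)[OF lim_1_over_n d(1)] .
  ultimately have "\<exists>\<^sub>F n in sequentially. 1 / real n < d \<and> orbit_mean n u < d"
    using frequently_eventually_conj by fastforce
  then show "\<exists>\<^sub>F n in sequentially. orbit_mean n x < e"
  proof (rule frequently_elim1)
    fix n assume "1 / real n < d \<and> orbit_mean n u < d"
    then have "C * (orbit_mean n u + 1 / real n) \<le> C * (2 * d)"
      using C by (intro mult_left_mono) auto
    then show "orbit_mean n x < e" using C(2)[of n] d by linarith
  qed
qed

lemma orbit_dominated_trans:
  assumes "orbit_dominated u v" "orbit_dominated v x"
  shows "orbit_dominated u x"
proof -
  obtain C D where C: "C \<ge> 0" "\<And>n. orbit_mean n v \<le> C * (orbit_mean n u + 1 / real n)"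
    and D: "D \<ge> 0" "\<And>n. orbit_mean n x \<le> D * (orbit_mean n v + 1 / real n)"
    using assms unfolding orbit_dominated_def by blast
  have "orbit_mean n x \<le> (D * (C + 1)) * (orbit_mean n u + 1 / real n)" for n
  proof -
    \<comment> \<open>The 1 in \<open>C + 1\<close> absorbs the additional term 1/n.\<close>
    have "orbit_mean n v + 1 / real n \<le> (C + 1) * (orbit_mean n u + 1 / real n)"
      using C(2)[of n] orbit_mean_nonneg[of n u] by (simp add: distrib_right)
    from mult_left_mono[OF this D(1)] D(2)[of n] show ?thesis by (simp add: mult.assoc)
  qed
  then show ?thesis
    unfolding orbit_dominated_def using C D by (intro exI[of _ "D * (C + 1)"]) auto
qed

lemma orbit_dominated_scale:
  assumes "orbit_dominated u x" "x \<in> X"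
  shows "orbit_dominated u (scale c x)"
proof -
  obtain C where C: "C \<ge> 0" "\<And>n. orbit_mean n x \<le> C * (orbit_mean n u + 1 / real n)"
    using assms(1) unfolding orbit_dominated_def by blast
  have "orbit_mean n (scale c x) \<le> ((1 + norm c) * C) * (orbit_mean n u + 1 / real n)" for n
    using orbit_mean_scale_le[OF assms(2), of n c] mult_left_mono[OF C(2)[of n], of "1 + norm c"]
    by (simp add: mult.assoc)
  then show ?thesis
    unfolding orbit_dominated_def using C by (intro exI[of _ "(1 + norm c) * C"]) auto
qed

lemma orbit_dominated_add:
  assumes "orbit_dominated u x" "orbit_dominated u y" "x \<in> X" "y \<in> X"
  shows "orbit_dominated u (x + y)"
proof -
  obtain C D where C: "C \<ge> 0" "\<And>n. orbit_mean n x \<le> C * (orbit_mean n u + 1 / real n)"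
    and D: "D \<ge> 0" "\<And>n. orbit_mean n y \<le> D * (orbit_mean n u + 1 / real n)"
    using assms(1,2) unfolding orbit_dominated_def by blast
  have "orbit_mean n (x + y) \<le> (C + D) * (orbit_mean n u + 1 / real n)" for n
    using orbit_mean_add_le[OF assms(3,4), of n] C(2)[of n] D(2)[of n]
    by (simp add: ring_distribs add_divide_distrib)
  then show ?thesis
    unfolding orbit_dominated_def using C D by (intro exI[of _ "C + D"]) auto
qed

lemma orbit_dominated_sum:
  assumes "finite I" "\<And>i. i \<in> I \<Longrightarrow> f i \<in> X \<and> orbit_dominated u (f i)"
  shows "orbit_dominated u (sum f I)"
  using assms
proof (induction rule: finite_induct)
  case empty
  show ?case unfolding orbit_dominated_def by (intro exI[of _ 0]) (simp add: orbit_mean_zero)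
next
  case (insert i I)
  then show ?case by (simp add: orbit_dominated_add sum_in)
qed

text \<open>Shifting by \<open>m\<close> costs m/n, which the term 1/n in
  \<open>orbit_dominated\<close> absorbs with constant m + 1. The case \<open>m = 0\<close> is
  reflexivity.\<close>

lemma orbit_dominated_power: "x \<in> X \<Longrightarrow> orbit_dominated x ((T ^^ m) x)"
  and orbit_dominated_power': "x \<in> X \<Longrightarrow> orbit_dominated ((T ^^ m) x) x"
proof -
  have *: "a + real m / real n \<le> real (Suc m) * (a + 1 / real n)" if "0 \<le> a" for a :: real and n
    using that by (simp add: ring_distribs add_divide_distrib)
  assume "x \<in> X"
  note ** = orbit_mean_power_le[OF this, of _ m]
  show "orbit_dominated x ((T ^^ m) x)" "orbit_dominated ((T ^^ m) x) x"
    unfolding orbit_dominated_def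
    using order_trans[OF **(1) *[OF orbit_mean_nonneg]] order_trans[OF **(2) *[OF orbit_mean_nonneg]]
    by (meson of_nat_0_le_iff)+
qed

section \<open>Reduction of mean Li-Yorke chaos to a single vector\<close>

lemma mean_Li_Yorke_chaotic_iff:
  "M.mean_Li_Yorke_chaotic T \<longleftrightarrow> (\<exists>x\<in>X. mean_semi_irregular x)"
proof
  assume "M.mean_Li_Yorke_chaotic T"
  then obtain S where S: "S \<subseteq> X" "uncountable S"
    "\<And>x y. x \<in> S \<Longrightarrow> y \<in> S \<Longrightarrow> x \<noteq> y \<Longrightarrow>
        liminf (\<lambda>n. ereal (1 / real n * (\<Sum>k=1..n. frechet_dist X p ((T ^^ k) x) ((T ^^ k) y)))) = 0 \<and>
        limsup (\<lambda>n. ereal (1 / real n * (\<Sum>k=1..n. frechet_dist X p ((T ^^ k) x) ((T ^^ k) y)))) > 0"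
    unfolding M.mean_Li_Yorke_chaotic_def by blast
  obtain x where x: "x \<in> S"
    using S(2) by (metis all_not_in_conv countable_empty)
  have "uncountable (S - {x})"
    using S(2) by (simp add: uncountable_minus_countable)
  then obtain y where y: "y \<in> S" "x \<noteq> y"
    by (metis Diff_iff all_not_in_conv countable_empty insertI1)
  have X: "x \<in> X" "y \<in> X" using S x y by auto
  have "mean_semi_irregular (x - y)"
    using S(3)[OF x y]
    unfolding mean_dist_eq_orbit_mean[OF X] liminf_ereal_eq_0_iff[OF orbit_mean_nonneg]
      limsup_ereal_pos_iff mean_semi_irregular_def mean_proximal_to_0_def .
  then show "\<exists>x\<in>X. mean_semi_irregular x" using X diff_in by blast
next
  assume "\<exists>x\<in>X. mean_semi_irregular x"
  then obtain x e where x: "x \<in> X" and prox: "mean_proximal_to_0 x"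
    and e: "e > 0" "\<exists>\<^sub>F n in sequentially. e < orbit_mean n x"
    unfolding mean_semi_irregular_def by blast
  have irr: "mean_semi_irregular (scale c x)" if "c \<noteq> 0" for c
    unfolding mean_semi_irregular_def
  proof (intro conjI exI)
    show "mean_proximal_to_0 (scale c x)"
      by (rule mean_proximal_dominated[OF prox orbit_dominated_scale])
         (use orbit_dominated_power[OF x, of 0] x in auto)
    \<comment> \<open>Scaling back by \<open>inverse c\<close> turns the upper bound for scalar
      multiples into a lower bound for the means of \<open>scale c x\<close>.\<close>
    have *: "orbit_mean n x \<le> (1 + norm (inverse c)) * orbit_mean n (scale c x)" for n
      using orbit_mean_scale_le[OF scale_in[OF x], of n "inverse c" c] that by simp
    have pos: "1 + norm (inverse c) > 0"
      by (rule add_pos_nonneg) auto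
    show "e / (1 + norm (inverse c)) > 0" using e pos by simp
    show "\<exists>\<^sub>F n in sequentially. e / (1 + norm (inverse c)) < orbit_mean n (scale c x)"
      using e(2)
    proof (rule frequently_elim1)
      fix n assume "e < orbit_mean n x"
      then have "e < (1 + norm (inverse c)) * orbit_mean n (scale c x)"
        using * order_less_le_trans by blast
      then show "e / (1 + norm (inverse c)) < orbit_mean n (scale c x)"
        using pos by (simp add: divide_less_eq mult.commute)
    qed
  qed
  have "x \<noteq> 0"
    using e orbit_mean_zero by auto
  \<comment> \<open>The reals embed in either scalar field, so the line of real multiples of
    \<open>x\<close> is already uncountable; differences of distinct points on it are nonzero
    multiples of \<open>x\<close>.\<close>
  define g where "g = (\<lambda>t::real. scale (of_real t) x)"
  have "inj g"
    using \<open>x \<noteq> 0\<close> by (auto simp: inj_def g_def)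
  then have "uncountable (range g)"
    using uncountable_UNIV_real countable_image_inj_eq by blast
  moreover have "range g \<subseteq> X"
    using x by (auto simp: g_def scale_in)
  moreover have diff_irr: "mean_semi_irregular (a - b)" if ab: "a \<in> range g" "b \<in> range g" "a \<noteq> b" for a b
  proof -
    obtain s t where "a = g s" "b = g t" using ab(1,2) by blast
    then have "a - b = scale (of_real (s - t)) x" "s \<noteq> t"
      using ab by (auto simp: g_def scale_left_diff_distrib)
    then show ?thesis using irr by simp
  qed
  ultimately show "M.mean_Li_Yorke_chaotic T"
    unfolding M.mean_Li_Yorke_chaotic_def
  proof (intro conjI T_cont exI[of _ "range g"] ballI impI)
    fix a b
    assume ab: "a \<in> range g" "b \<in> range g" "a \<noteq> b"
    then have X: "a \<in> X" "b \<in> X" and irr: "mean_semi_irregular (a - b)"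
      using \<open>range g \<subseteq> X\<close> diff_irr by blast+
    note irr = irr[unfolded mean_semi_irregular_def mean_proximal_to_0_def
        liminf_ereal_eq_0_iff[OF orbit_mean_nonneg, symmetric] limsup_ereal_pos_iff[symmetric]]
    show "liminf (\<lambda>n. ereal (1 / real n * (\<Sum>k=1..n. frechet_dist X p ((T ^^ k) a) ((T ^^ k) b)))) = 0"
      and "limsup (\<lambda>n. ereal (1 / real n * (\<Sum>k=1..n. frechet_dist X p ((T ^^ k) a) ((T ^^ k) b)))) > 0"
      unfolding mean_dist_eq_orbit_mean[OF X] using irr by blast+
  qed
qed

section \<open>Semi-irregular vectors by Baire category\<close>

lemma mean_semi_irregular_exists:
  assumes dense: "\<And>x r. x \<in> X \<Longrightarrow> r > 0 \<Longrightarrow> \<exists>y\<in>X. mean_proximal_to_0 y \<and> frechet_dist X p x y < r"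
    and \<epsilon>: "\<epsilon> > 0"
    and grow: "\<And>d m. d > 0 \<Longrightarrow> \<exists>y\<in>X. \<exists>n\<ge>m. fnorm y < d \<and> \<epsilon> \<le> orbit_mean n y"
  shows "\<exists>x\<in>X. mean_semi_irregular x"
proof -
  \<comment> \<open>Lying in every \<open>U k\<close> forces small means at arbitrarily late times,
    lying in every \<open>V k\<close> means above \<epsilon>/4 at arbitrarily late times.\<close>
  define U where "U k = (\<Union>n\<in>{k..}. {x \<in> topspace (frechet_topology X p). orbit_mean n x \<in> {..<1 / real (Suc k)}})"
    for k
  define V where "V k = (\<Union>n\<in>{k..}. {x \<in> topspace (frechet_topology X p). orbit_mean n x \<in> {\<epsilon> / 4<..}})"
    for k :: nat
  have level: "openin (frechet_topology X p) {x \<in> topspace (frechet_topology X p). orbit_mean n x \<in> S}"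
    if "open S" for n S
    using that by (intro openin_continuous_map_preimage[OF continuous_orbit_mean]) simp
  have U: "openin (frechet_topology X p) (U k)" for k
    unfolding U_def
    by (rule openin_Union) (blast intro: level open_lessThan)
  have V: "openin (frechet_topology X p) (V k)" for k
    unfolding V_def
    by (rule openin_Union) (blast intro: level open_greaterThan)
  have U_dense: "frechet_topology X p closure_of U k = X" for k
  proof -
    have "\<exists>y\<in>U k. y \<in> M.mball x r" if x: "x \<in> X" "r > 0" for x r
    proof -
      obtain y where y: "y \<in> X" "mean_proximal_to_0 y" "frechet_dist X p x y < r"
        using dense[OF x] by blast
      have "\<exists>\<^sub>F n in sequentially. orbit_mean n y < 1 / real (Suc k)"
        using y(2) unfolding mean_proximal_to_0_def by simp
      then obtain n where "n \<ge> k" "orbit_mean n y < 1 / real (Suc k)"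
        unfolding frequently_sequentially by blast
      then have "y \<in> U k" using y by (auto simp: U_def)
      then show ?thesis using x y by auto
    qed
    then show ?thesis by (auto simp: M.metric_closure_of)
  qed
  have V_dense: "frechet_topology X p closure_of V k = X" for k
  proof -
    have "\<exists>y\<in>V k. y \<in> M.mball x r" if x: "x \<in> X" "r > 0" for x r
    proof -
      obtain z n where z: "z \<in> X" "n \<ge> k" "fnorm z < r" "\<epsilon> \<le> orbit_mean n z"
        using grow[OF x(2)] by blast
      \<comment> \<open>Recovering \<open>z\<close> as (x + z) - x shows that its large mean must
        come from \<open>x + z\<close> or from \<open>x\<close>; the factor 2 below is 1 +
        |-1|.\<close>
      have "orbit_mean n ((x + z) + scale (- 1) x)
          \<le> orbit_mean n (x + z) + orbit_mean n (scale (- 1) x)"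
        using x z by (intro orbit_mean_add_le add_in scale_in)
      also have "orbit_mean n (scale (- 1) x) \<le> 2 * orbit_mean n x"
        using orbit_mean_scale_le[OF x(1), of n "- 1"] by simp
      finally have "\<epsilon> \<le> orbit_mean n (x + z) + 2 * orbit_mean n x"
        using z by simp
      \<comment> \<open>If both means were at most \<epsilon>/4, the bound would give at most
        3\<epsilon>/4. In the first case \<open>x\<close> itself lies in \<open>V k\<close>, in the
        second its small perturbation \<open>x + z\<close> does.\<close>
      then consider "\<epsilon> / 4 < orbit_mean n x" | "\<epsilon> / 4 < orbit_mean n (x + z)"
        using \<epsilon> by linarith
      then show ?thesis
      proof cases
        case 1
        then have "x \<in> V k" using x z by (auto simp: V_def)
        then show ?thesis using x by auto
      next
        case 2
        then have "x + z \<in> V k" using x z by (auto simp: V_def add_in)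
        moreover have "frechet_dist X p (x + z) x = fnorm z"
          using frechet_dist_eq_fnorm[of "x + z" x] x z by (simp add: add_in)
        then have "frechet_dist X p x (x + z) = fnorm z"
          by (simp only: M.commute[of x])
        ultimately show ?thesis using x z by (intro bexI[of _ "x + z"]) (auto simp: add_in)
      qed
    qed
    then show ?thesis by (auto simp: M.metric_closure_of)
  qed
  have "frechet_topology X p closure_of \<Inter>(range U \<union> range V) = X"
    by (rule M.metric_Baire_category[OF complete]) (use U V U_dense V_dense in auto)
  then have "\<Inter>(range U \<union> range V) \<noteq> {}"
    using zero_in by (metis closure_of_empty empty_iff)
  then obtain x where "x \<in> \<Inter>(range U \<union> range V)" by blast
  then have x: "x \<in> U k" "x \<in> V k" for k by blast+
  have "mean_proximal_to_0 x"
    unfolding mean_proximal_to_0_def frequently_sequentially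
  proof (intro allI impI)
    fix e :: real and m :: nat
    assume "e > 0"
    then obtain j where j: "1 / real (Suc j) < e"
      using nat_approx_posE by metis
    \<comment> \<open>The maximum makes one index late enough for \<open>m\<close> and the mean
      small enough for \<open>j\<close>.\<close>
    obtain n where n: "n \<ge> max m j" "orbit_mean n x < 1 / real (Suc (max m j))"
      using x(1)[of "max m j"] by (auto simp: U_def)
    have "1 / real (Suc (max m j)) \<le> 1 / real (Suc j)"
      by (intro divide_left_mono) auto
    then show "\<exists>n\<ge>m. orbit_mean n x < e" using n j by (intro exI[of _ n]) linarith
  qed
  moreover have "\<exists>\<^sub>F n in sequentially. \<epsilon> / 4 < orbit_mean n x"
    unfolding frequently_sequentially using x(2) by (fastforce simp: V_def)
  moreover have "x \<in> X" using x(1) by (auto simp: U_def)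
  ultimately show ?thesis
    using \<epsilon> unfolding mean_semi_irregular_def by (metis divide_pos_pos zero_less_numeral)
qed

end

subsection \<open>Weighted shifts\<close>

lemma weighted_shift_power:
  "(weighted_shift w ^^ i) x n = (\<Prod>l=n..n + int i - 1. w l) * x (n + int i)"
proof (induction i arbitrary: n)
  case (Suc i)
  have "{n..n + int i} = insert n {n + 1..n + int i}" by auto
  then have "(\<Prod>l=n..n + int i. w l) = w n * (\<Prod>l=n + 1..n + int i. w l)" by simp
  moreover have "(weighted_shift w ^^ Suc i) x n = w n * (weighted_shift w ^^ i) x (n + 1)"
    by (simp add: weighted_shift_def[of w "(weighted_shift w ^^ i) x"])
  moreover have "(n + 1) + int i = n + int (Suc i)" by simp
  ultimately show ?case
    by (simp only: Suc) (simp add: mult.assoc)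
qed simp

text \<open>This produces the weight products of both conditions: (A) is the case of
  \<open>j = 0\<close> and \<open>c = 1\<close>, and (B) sums over \<open>j\<close>.\<close>

lemma weighted_shift_power_canonical:
  "(weighted_shift w ^^ i) (seq_scale c (canonical_vector j))
    = seq_scale (c * (\<Prod>l=j - int i..j - 1. w l)) (canonical_vector (j - int i))"
  by (rule ext) (auto simp: weighted_shift_power seq_scale_def canonical_vector_def)

locale frechet_weighted_shift = frechet_sequence_space X p
  for X :: "(int \<Rightarrow> 'k::real_or_complex) set" and p +
  fixes w :: "int \<Rightarrow> 'k"
  assumes basis: "canonical_basis X p"
    and coordinate_le: "\<And>n m x. n \<ge> 1 \<Longrightarrow> x \<in> X \<Longrightarrow> norm (x m) * p n (canonical_vector m) \<le> p n x"
    and weight_nonzero: "\<And>n. w n \<noteq> 0"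
    and shift_in: "weighted_shift w ` X \<subseteq> X"
    and shift_cont: "continuous_map (frechet_topology X p) (frechet_topology X p) (weighted_shift w)"
begin

sublocale frechet_operator seq_scale X p "weighted_shift w"
  using shift_in shift_cont
  by unfold_locales (auto simp: weighted_shift_def seq_scale_def algebra_simps fun_eq_iff)

section \<open>Truncations to finitely many coordinates\<close>

lemma canonical_in: "canonical_vector n \<in> X"
  using basis by (auto simp: canonical_basis_def)

definition finite_vector :: "nat \<Rightarrow> (int \<Rightarrow> 'k) \<Rightarrow> int \<Rightarrow> 'k"
  where "finite_vector r b = (\<Sum>j=- int r..int r. seq_scale (b j) (canonical_vector j))"

lemma finite_vector_in: "finite_vector r b \<in> X"
  unfolding finite_vector_def by (intro sum_in scale_in canonical_in)

lemma power_finite_vector: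
  "(weighted_shift w ^^ i) (finite_vector r b) = (\<Sum>j=- int r..int r.
     seq_scale (b j * (\<Prod>l=j - int i..j - 1. w l)) (canonical_vector (j - int i)))"
  unfolding finite_vector_def
  by (simp add: power_sum scale_in canonical_in weighted_shift_power_canonical)

text \<open>Matches the symmetric truncation with the two one-sided partial sums of the basis
  expansion; \<open>Suc r\<close> appears because index 0 belongs to the first of them.\<close>

lemma finite_vector_split:
  "finite_vector r x = (\<Sum>n<Suc r. seq_scale (x (int n)) (canonical_vector (int n)))
     + (\<Sum>n=1..r. seq_scale (x (- int n)) (canonical_vector (- int n)))"
proof (induction r)
  case (Suc r)
  have "{- int (Suc r)..int (Suc r)} = insert (int (Suc r)) (insert (- int (Suc r)) {- int r..int r})"
    by auto
  then have "finite_vector (Suc r) x = seq_scale (x (int (Suc r))) (canonical_vector (int (Suc r)))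
      + (seq_scale (x (- int (Suc r))) (canonical_vector (- int (Suc r))) + finite_vector r x)"
    unfolding finite_vector_def by simp
  then show ?case unfolding Suc by (simp add: add_ac)
qed (simp add: finite_vector_def)

lemma finite_vector_limit:
  assumes "x \<in> X"
  shows "limitin (frechet_topology X p) (\<lambda>r. finite_vector r x) x sequentially"
proof -
  let ?a = "\<lambda>N. \<Sum>n<N. seq_scale (x (int n)) (canonical_vector (int n))"
  let ?b = "\<lambda>N. \<Sum>n=1..N. seq_scale (x (- int n)) (canonical_vector (- int n))"
  obtain y z where yz: "x = y + z" "limitin (frechet_topology X p) ?a y sequentially"
      "limitin (frechet_topology X p) ?b z sequentially"
    using basis assms unfolding canonical_basis_def by blast
  have in_X: "y \<in> X" "z \<in> X" "?a N \<in> X" "?b N \<in> X" for N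
    using yz by (auto simp: M.limitin_metric_dist_null intro!: sum_in scale_in canonical_in)
  have lim: "(\<lambda>N. frechet_dist X p (?a (Suc N)) y + frechet_dist X p (?b N) z) \<longlonglongrightarrow> 0 + 0"
    using yz unfolding M.limitin_metric_dist_null by (intro tendsto_add LIMSEQ_Suc) auto
  have bound: "frechet_dist X p (finite_vector N x) x
      \<le> frechet_dist X p (?a (Suc N)) y + frechet_dist X p (?b N) z" for N
  proof -
    have "finite_vector N x - x = (?a (Suc N) - y) + (?b N - z)"
      unfolding finite_vector_split yz(1) by (simp add: algebra_simps)
    then show ?thesis
      using fnorm_triangle[of "?a (Suc N) - y" "?b N - z"] in_X assms
      by (simp only: frechet_dist_eq_fnorm finite_vector_in diff_in)
  qed
  have "(\<lambda>N. frechet_dist X p (finite_vector N x) x) \<longlonglongrightarrow> 0"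
  proof (rule Lim_null_comparison)
    show "\<forall>\<^sub>F N in sequentially. norm (frechet_dist X p (finite_vector N x) x)
        \<le> frechet_dist X p (?a (Suc N)) y + frechet_dist X p (?b N) z"
      using bound by (intro always_eventually allI) (simp only: real_norm_def M.abs_mdist)
    show "(\<lambda>N. frechet_dist X p (?a (Suc N)) y + frechet_dist X p (?b N) z) \<longlonglongrightarrow> 0"
      using lim by (simp only: add_0)
  qed
  then show ?thesis
    by (simp add: M.limitin_metric_dist_null assms finite_vector_in)
qed

section \<open>Coordinates, canonical vectors and condition (A)\<close>

lemma fnorm_coordinate_le:
  assumes "x \<in> X"
  shows "fnorm (seq_scale (x m) (canonical_vector m)) \<le> fnorm x"
  by (rule fnorm_mono) (simp_all add: assms scale_in canonical_in seminorm_scale coordinate_le)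

text \<open>The shift moves coordinate \<open>m\<close> to m - k in \<open>k\<close> steps, so the
  orbit of the coordinate part of \<open>x\<close> consists of coordinate parts of the orbit of
  \<open>x\<close>.\<close>

lemma orbit_mean_coordinate_le:
  assumes "x \<in> X"
  shows "orbit_mean n (seq_scale (x m) (canonical_vector m)) \<le> orbit_mean n x"
proof -
  have "fnorm ((weighted_shift w ^^ k) (seq_scale (x m) (canonical_vector m)))
      \<le> fnorm ((weighted_shift w ^^ k) x)" for k
    using fnorm_coordinate_le[OF power_in[OF assms, of k], of "m - int k"]
    by (simp add: weighted_shift_power_canonical weighted_shift_power mult.commute)
  then show ?thesis
    unfolding orbit_mean_def by (intro mult_left_mono sum_mono) auto
qed

lemma power_canonical_dominates:
  assumes "i \<le> j"
  obtains m c where "c \<noteq> 0"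
    "(weighted_shift w ^^ m) (canonical_vector j) = seq_scale c (canonical_vector i)"
proof
  show "(\<Prod>l=i..j - 1. w l) \<noteq> 0" by (simp add: weight_nonzero)
  show "(weighted_shift w ^^ nat (j - i)) (canonical_vector j)
      = seq_scale (\<Prod>l=i..j - 1. w l) (canonical_vector i)"
    using weighted_shift_power_canonical[of "nat (j - i)" w 1 j] assms
    by (simp add: seq_scale_def)
qed

text \<open>For \<open>i \<le> j\<close> the orbit of \<open>canonical_vector j\<close> meets the
  line of \<open>canonical_vector i\<close>, and an orbit point dominates its starting vector.
  Otherwise the roles are exchanged, and the nonzero scalar is divided out.\<close>

lemma canonical_dominated: "orbit_dominated (canonical_vector i) (canonical_vector j)"
proof (cases "i \<le> j")
  case True
  then obtain m c where
    "(weighted_shift w ^^ m) (canonical_vector j) = seq_scale c (canonical_vector i)"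
    by (rule power_canonical_dominates)
  then have "orbit_dominated (seq_scale c (canonical_vector i)) (canonical_vector j)"
    using orbit_dominated_power'[OF canonical_in, of m j] by simp
  moreover have "orbit_dominated (canonical_vector i) (seq_scale c (canonical_vector i))"
    using orbit_dominated_scale[OF orbit_dominated_power[OF canonical_in, of i 0]] canonical_in
    by simp
  ultimately show ?thesis using orbit_dominated_trans by blast
next
  case False
  then obtain m c where c: "c \<noteq> 0"
    "(weighted_shift w ^^ m) (canonical_vector i) = seq_scale c (canonical_vector j)"
    by (meson linear power_canonical_dominates)
  then have "orbit_dominated (canonical_vector i) (seq_scale c (canonical_vector j))"
    using orbit_dominated_power[OF canonical_in, of i m] by simp
  from orbit_dominated_scale[OF this, of "inverse c"] show ?thesis
    using c canonical_in scale_in by simp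
qed

lemma mean_proximal_finite_vector:
  assumes "mean_proximal_to_0 (canonical_vector 0)"
  shows "mean_proximal_to_0 (finite_vector r b)"
  by (rule mean_proximal_dominated[OF assms])
     (auto simp: finite_vector_def
       intro!: orbit_dominated_sum orbit_dominated_scale canonical_dominated canonical_in scale_in)

lemma mean_proximal_canonical:
  assumes "x \<in> X" "mean_proximal_to_0 x" "x \<noteq> 0"
  shows "mean_proximal_to_0 (canonical_vector 0)"
proof -
  obtain m where m: "x m \<noteq> 0" using assms(3) by (auto simp: fun_eq_iff)
  have "orbit_mean n (seq_scale (x m) (canonical_vector m)) \<le> 1 * (orbit_mean n x + 1 / real n)" for n
    using orbit_mean_coordinate_le[OF assms(1), of n m] by (simp add: add_increasing2)
  then have "orbit_dominated x (seq_scale (x m) (canonical_vector m))"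
    unfolding orbit_dominated_def by (intro exI[of _ 1]) auto
  from orbit_dominated_scale[OF this, of "inverse (x m)"]
  have "orbit_dominated x (canonical_vector m)"
    using m canonical_in scale_in by simp
  with assms(2) show ?thesis
    using canonical_dominated mean_proximal_dominated by blast
qed

section \<open>Semi-irregular vectors and condition (B)\<close>

lemma finite_vector_grows:
  assumes x: "x \<in> X" and prox: "mean_proximal_to_0 x"
    and e: "e > 0" "\<exists>\<^sub>F n in sequentially. e < orbit_mean n x" and "d > 0"
  shows "\<exists>n>m. \<exists>r\<ge>1. \<exists>b. fnorm (finite_vector r b) < d \<and> e / 2 \<le> orbit_mean n (finite_vector r b)"
proof -
  \<comment> \<open>The choices are ordered: first \<open>j\<close> makes an orbit point
    \<open>v\<close> small, then \<open>n\<close> is taken so late that passing from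
    \<open>x\<close> to \<open>v\<close> loses less than e/2 of a mean exceeding \<open>e\<close>,
    and last a truncation length \<open>r\<close> is found.\<close>
  obtain j where j: "fnorm ((weighted_shift w ^^ j) x) < d"
    using orbit_comes_near_0[OF prox \<open>d > 0\<close>] .
  define v where "v = (weighted_shift w ^^ j) x"
  have v: "v \<in> X" using x by (simp add: v_def power_in)
  have "(\<lambda>n. real j / real n) \<longlonglongrightarrow> 0"
    by (rule lim_const_over_n)
  then have "\<forall>\<^sub>F n in sequentially. real j / real n < e / 2"
    using e by (intro order_tendstoD(2)) auto
  then have "\<exists>\<^sub>F n in sequentially. (real j / real n < e / 2 \<and> m < n) \<and> e < orbit_mean n x"
    using e(2) eventually_gt_at_top[of m]
    by (intro frequently_eventually_conj eventually_conj)
  then obtain n where n: "real j / real n < e / 2" "m < n" "e < orbit_mean n x"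
    using frequently_ex by fastforce
  then have n': "e / 2 < orbit_mean n v"
    using orbit_mean_power_le(2)[OF x, of n j] unfolding v_def by linarith
  \<comment> \<open>With \<open>n\<close> fixed, both strict inequalities for \<open>v\<close> are
    open conditions and pass to its long truncations.\<close>
  have "(\<lambda>r. orbit_mean n (finite_vector r v)) \<longlonglongrightarrow> orbit_mean n v"
    using continuous_map_limit[OF continuous_orbit_mean finite_vector_limit[OF v], of n]
    by (simp add: comp_def)
  then have "\<forall>\<^sub>F r in sequentially. e / 2 < orbit_mean n (finite_vector r v)"
    using n' by (rule order_tendstoD(1))
  moreover have "(\<lambda>r. fnorm (finite_vector r v)) \<longlonglongrightarrow> fnorm v"
    using continuous_map_limit[OF continuous_fnorm_power[of 0] finite_vector_limit[OF v]]
    by (simp add: comp_def)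
  then have "\<forall>\<^sub>F r in sequentially. fnorm (finite_vector r v) < d"
    using j unfolding v_def by (rule order_tendstoD(2))
  ultimately have "\<forall>\<^sub>F r in sequentially. r \<ge> 1 \<and> fnorm (finite_vector r v) < d
      \<and> e / 2 < orbit_mean n (finite_vector r v)"
    using eventually_ge_at_top[of 1] by eventually_elim simp
  then obtain r where "r \<ge> 1" "fnorm (finite_vector r v) < d"
      "e / 2 < orbit_mean n (finite_vector r v)"
    using eventually_happens'[OF sequentially_bot] by blast
  with n show ?thesis by (meson less_imp_le)
qed

text \<open>Condition (B) in terms of orbit means, with the quantifiers arranged so that unfolding
  returns the wording of the theorem.\<close>

definition small_vectors_escape :: bool
  where "small_vectors_escape \<longleftrightarrow> (\<exists>\<epsilon>::real. \<epsilon> > 0 \<and> (\<exists>N::nat \<Rightarrow> nat. strict_mono_on {1..} N \<and> (\<forall>k\<ge>1. N k \<ge> 1) \<and>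
      (\<forall>k\<ge>1. \<exists>r::nat. r \<ge> 1 \<and> (\<exists>b. fnorm (finite_vector r b) < 1 / real k \<and>
        orbit_mean (N k) (finite_vector r b) \<ge> \<epsilon>))))"

lemma mean_semi_irregular_imp_growth:
  assumes x: "x \<in> X" "mean_semi_irregular x"
  shows "small_vectors_escape"
proof -
  obtain e where prox: "mean_proximal_to_0 x" and e: "e > 0" "\<exists>\<^sub>F n in sequentially. e < orbit_mean n x"
    using x(2) unfolding mean_semi_irregular_def by blast
  note grow = finite_vector_grows[OF x(1) prox e]
  \<comment> \<open>The recursive choice starts at 0 whereas (B) starts at 1; the guard leaves the
    value at 0 free.\<close>
  let ?P = "\<lambda>k n. k \<ge> 1 \<longrightarrow> n \<ge> 1 \<and> (\<exists>r\<ge>1. \<exists>b. fnorm (finite_vector r b) < 1 / real k \<and>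
        orbit_mean n (finite_vector r b) \<ge> e / 2)"
  have "\<exists>N. \<forall>k. ?P k (N k) \<and> N k < N (Suc k)"
  proof (rule dependent_nat_choice)
    show "\<exists>n. ?P 0 n" by simp
    show "\<exists>n'. ?P (Suc k) n' \<and> n < n'" for n k
    proof -
      obtain n' r b where "n' > n" "r \<ge> 1" "fnorm (finite_vector r b) < 1 / real (Suc k)"
          "e / 2 \<le> orbit_mean n' (finite_vector r b)"
        using grow[of "1 / real (Suc k)" n] by auto
      then show ?thesis by (intro exI[of _ n']) auto
    qed
  qed
  then obtain N where N: "\<And>k. ?P k (N k)" "\<And>k. N k < N (Suc k)" by blast
  have "strict_mono N" using N(2) by (simp add: strict_mono_Suc_iff)
  then have "strict_mono_on {1..} N" by (simp add: strict_mono_on_def strict_mono_def)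
  with N(1) e show ?thesis
    unfolding small_vectors_escape_def by (intro exI[of _ "e / 2"] conjI exI[of _ N]) auto
qed

lemma growth_imp_mean_semi_irregular:
  assumes "mean_proximal_to_0 (canonical_vector 0)" "small_vectors_escape"
  shows "\<exists>x\<in>X. mean_semi_irregular x"
proof -
  obtain \<epsilon> N where \<epsilon>: "\<epsilon> > 0" and N: "strict_mono_on {1..} N"
    and N_pos: "\<forall>k\<ge>1. N k \<ge> 1"
    and grow: "\<forall>k\<ge>1. \<exists>r\<ge>1. \<exists>b. fnorm (finite_vector r b) < 1 / real k \<and>
        orbit_mean (N k) (finite_vector r b) \<ge> \<epsilon>"
    using assms(2) unfolding small_vectors_escape_def by (elim exE conjE) (rule that)
  \<comment> \<open>Strictly increasing positive integers outgrow their index; the successor keeps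
    the induction within the range from 1 on.\<close>
  have N_ge: "Suc k \<le> N (Suc k)" for k
  proof (induction k)
    case 0
    show ?case using N_pos by simp
  next
    case (Suc k)
    have "N (Suc k) < N (Suc (Suc k))"
      using N by (rule strict_mono_onD) auto
    with Suc show ?case by simp
  qed
  show ?thesis
  proof (rule mean_semi_irregular_exists[OF _ \<epsilon>])
    fix x and r :: real
    assume "x \<in> X" "r > 0"
    have "\<forall>\<^sub>F n in sequentially. frechet_dist X p (finite_vector n x) x < r"
      using finite_vector_limit[OF \<open>x \<in> X\<close>] \<open>r > 0\<close>
      unfolding M.limitin_metric_dist_null by (elim conjE) (rule order_tendstoD(2))
    then obtain n where "frechet_dist X p (finite_vector n x) x < r"
      using eventually_happens'[OF sequentially_bot] by blast
    then show "\<exists>y\<in>X. mean_proximal_to_0 y \<and> frechet_dist X p x y < r"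
      using mean_proximal_finite_vector[OF assms(1)]
      by (intro bexI[OF _ finite_vector_in[of n x]]) (simp add: M.commute[of x])
  next
    fix d :: real and m :: nat
    assume "d > 0"
    then obtain j where j: "1 / real (Suc j) < d"
      using nat_approx_posE by metis
    \<comment> \<open>This makes 1/k less than \<open>d\<close> through \<open>j\<close>, and
      \<open>N k\<close> at least \<open>m\<close> through \<open>N_ge\<close>.\<close>
    define k where "k = Suc (max m j)"
    obtain r b where rb: "fnorm (finite_vector r b) < 1 / real k"
        "orbit_mean (N k) (finite_vector r b) \<ge> \<epsilon>"
      using grow[rule_format, of k] by (auto simp: k_def)
    have "1 / real k \<le> 1 / real (Suc j)"
      unfolding k_def by (intro divide_left_mono) auto
    moreover have "m \<le> N k"
      using N_ge[of "max m j"] by (simp add: k_def)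
    ultimately show "\<exists>y\<in>X. \<exists>n\<ge>m. fnorm y < d \<and> \<epsilon> \<le> orbit_mean n y"
      using rb j by (intro bexI[OF _ finite_vector_in[of r b]] exI[of _ "N k"]) auto
  qed
qed

lemma mean_Li_Yorke_chaotic_shift_iff:
  "M.mean_Li_Yorke_chaotic (weighted_shift w) \<longleftrightarrow>
     mean_proximal_to_0 (canonical_vector 0) \<and> small_vectors_escape"
  unfolding mean_Li_Yorke_chaotic_iff
proof (intro iffI conjI)
  assume "\<exists>x\<in>X. mean_semi_irregular x"
  then obtain x where x: "x \<in> X" "mean_semi_irregular x" by (rule bexE)
  then have "mean_proximal_to_0 x" unfolding mean_semi_irregular_def by (elim conjE)
  then show "mean_proximal_to_0 (canonical_vector 0)"
    using x by (intro mean_proximal_canonical mean_semi_irregular_nonzero)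
  show small_vectors_escape using x by (rule mean_semi_irregular_imp_growth)
qed (elim conjE, rule growth_imp_mean_semi_irregular)

text \<open>Identifies the means in (A) as the orbit means of \<open>canonical_vector 0\<close>, so
  that (A) becomes mean proximality of that vector to 0.\<close>

lemma orbit_mean_canonical:
  "orbit_mean n (canonical_vector 0) = 1 / real n *
     (\<Sum>k=1..n. fnorm (seq_scale (\<Prod>l=- int k..-1. w l) (canonical_vector (- int k))))"
proof -
  have "seq_scale 1 (canonical_vector 0) = (canonical_vector 0 :: int \<Rightarrow> 'k)"
    by (simp add: seq_scale_def)
  then show ?thesis
    using weighted_shift_power_canonical[of _ w 1 0] by (simp add: orbit_mean_def)
qed

end


theorem theorem30:
  fixes X :: "(int \<Rightarrow> 'k::real_or_complex) set"
    and p :: "nat \<Rightarrow> (int \<Rightarrow> 'k) \<Rightarrow> real"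
    and w :: "int \<Rightarrow> 'k"
  assumes "frechet_sequence_space X p"
    and "canonical_basis X p"
    and "\<And>n m x. n \<ge> 1 \<Longrightarrow> x \<in> X \<Longrightarrow> norm (x m) * p n (canonical_vector m) \<le> p n x"
    and "\<And>n. w n \<noteq> 0"
    and "weighted_shift w ` X \<subseteq> X"
    and "continuous_map (frechet_topology X p) (frechet_topology X p) (weighted_shift w)"
  shows "Metric_space.mean_Li_Yorke_chaotic X (frechet_dist X p) (weighted_shift w) \<longleftrightarrow>
    liminf (\<lambda>n. ereal (1 / real n *
      (\<Sum>k=1..n. frechet_dist X p
         (seq_scale (\<Prod>l=- int k..-1. w l) (canonical_vector (- int k))) 0))) = 0 \<and>
    (\<exists>\<epsilon>::real. \<epsilon> > 0 \<and> (\<exists>N::nat \<Rightarrow> nat. strict_mono_on {1..} N \<and> (\<forall>k\<ge>1. N k \<ge> 1) \<and>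
      (\<forall>k\<ge>1. \<exists>r::nat. r \<ge> 1 \<and> (\<exists>b :: int \<Rightarrow> 'k.
        frechet_dist X p
          (\<Sum>j=- int r..int r. seq_scale (b j) (canonical_vector j)) 0 < 1 / real k \<and>
        1 / real (N k) *
          (\<Sum>i=1..N k. frechet_dist X p
             (\<Sum>j=- int r..int r.
                seq_scale (b j * (\<Prod>l=j - int i..j - 1. w l)) (canonical_vector (j - int i))) 0)
          \<ge> \<epsilon>))))"
proof -
  interpret frechet_weighted_shift X p w
    by (rule frechet_weighted_shift.intro[OF assms(1) frechet_weighted_shift_axioms.intro[OF assms(2-6)]])
  \<comment> \<open>The order of unfolding matters: the lower limit and
    \<open>orbit_mean_canonical\<close> are rewritten while \<open>orbit_mean\<close> is still
    folded, and powers of the shift are evaluated before \<open>finite_vector\<close> is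
    expanded.\<close>
  show ?thesis
    using mean_Li_Yorke_chaotic_shift_iff
    unfolding mean_proximal_to_0_def liminf_ereal_eq_0_iff[OF orbit_mean_nonneg, symmetric]
    unfolding small_vectors_escape_def orbit_mean_canonical
    unfolding orbit_mean_def power_finite_vector
    unfolding finite_vector_def .
qed

end
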